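(* Let $A\in\mathbb{R}^{n\times n}$, $B\in\mathbb{R}^{n\times m}$, $K\in\mathbb{R}^{m\times n}$ be such that $(A,B)$ is stabilizable and $A_{cl}=A-BK$ is Hurwitz. Let $Q\in\mathbb{R}^{n\times n}$ be symmetric positive definite, let $P$ be the unique symmetric positive definite solution of $A_{cl}^\top P+PA_{cl}=-Q$, and let $\sigma\in(0,1)$. Consider the event-triggered closed-loop system $$\dot x(t)=Ax(t)-BKx(t_k),\qquad t\in[t_k,t_{k+1}),$$ where, with $e(t)=x(t)-x(t_k)$, the transmission instants $t_k$ are generated by the rule that an event is triggered when $$\sigma\, x(t)^\top P x(t)-2\,x(t)^\top PBK\,e(t)\le 0 .$$ Then there exists $\tau>0$ such that $t_{k+1}-t_k\ge\tau$ for all $k\ge0$.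
   Context: The plant is $\dot x=Ax+Bu$, $x(t)\in\mathbb{R}^n$, $u(t)\in\mathbb{R}^m$, with zero-order-hold input $u(t)=-Kx(t_k)$ for $t\in[t_k,t_{k+1})$, where $\{t_k\}_{k=0}^\infty$ is the sequence of transmission instants; equivalently $\dot x=A_{cl}x+BKe$, where $e(t)=x(t)-x(t_k)$ is the sampling-induced error. When an event is triggered, the current state is transmitted and becomes the new held state, so the error resets to zero; thus $t_{k+1}$ is the next time after $t_k$ at which the triggering inequality holds.
   Formalization: If x(t_k)=0, the triggering inequality reads 0≤0 at all later times, so no next event time exists (an infimum would give gap 0); in this case it is stipulated that no further event occurs, t_{k+1}=∞. The bound is claimed for all k with t_k finite. *)

theory Defs
  imports "HOL-Analysis.Analysis"
begin

definition hurwitz :: "real^'n^'n \<Rightarrow> bool" where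
  "hurwitz M \<longleftrightarrow>
     (\<forall>(l::complex) (v::complex^'n).
        v \<noteq> 0 \<and> map_matrix complex_of_real M *v v = l *s v \<longrightarrow> Re l < 0)"

definition stabilizable :: "real^'n^'n \<Rightarrow> real^'m^'n \<Rightarrow> bool" where
  "stabilizable A B \<longleftrightarrow> (\<exists>F::real^'n^'m. hurwitz (A + B ** F))"

definition sym_pos_def :: "real^'n^'n \<Rightarrow> bool" where
  "sym_pos_def M \<longleftrightarrow> transpose M = M \<and> (\<forall>x. x \<noteq> 0 \<longrightarrow> x \<bullet> (M *v x) > 0)"

text \<open>
  The flow on \<open>{a..}\<close> under the input \<open>- K *v y a\<close> held from time \<open>a\<close> on. At \<open>a\<close> the
  derivative is one-sided.
\<close>

definition held_flow ::
  "real^'n^'n \<Rightarrow> real^'m^'n \<Rightarrow> real^'n^'m \<Rightarrow> real \<Rightarrow> (real \<Rightarrow> real^'n) \<Rightarrow> bool" where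
  "held_flow A B K a y \<longleftrightarrow>
     (\<forall>s\<ge>a. (y has_vector_derivative (A *v y s - (B ** K) *v y a)) (at s within {a..}))"

definition triggered ::
  "real^'m^'n \<Rightarrow> real^'n^'m \<Rightarrow> real^'n^'n \<Rightarrow> real \<Rightarrow> real^'n \<Rightarrow> real^'n \<Rightarrow> bool" where
  "triggered B K P \<sigma> x e \<longleftrightarrow>
     \<sigma> * (x \<bullet> (P *v x)) - 2 * (x \<bullet> ((P ** B ** K) *v e)) \<le> 0"

text \<open>
  The next transmission instant after \<open>a\<close>, where \<open>y\<close> is the flow with the state held since
  \<open>a\<close>. The value is \<open>\<infinity>\<close> if the inequality never holds after \<open>a\<close>.

  If \<open>y a = 0\<close>, the flow stays at the origin and the inequality reads \<open>0 \<le> 0\<close> at every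
  time after \<open>a\<close>. There is then no first such time, and we let no further event
  occur; the infimum would be \<open>a\<close> itself. This case cannot be excluded by assuming a nonzero initial
  state: with \<open>A = 0\<close> and \<open>B = K = 1\<close> in dimension one, the held flow reaches the
  origin in finite time, with its first event there.
\<close>

definition next_instant ::
  "real^'m^'n \<Rightarrow> real^'n^'m \<Rightarrow> real^'n^'n \<Rightarrow> real \<Rightarrow> real \<Rightarrow> (real \<Rightarrow> real^'n) \<Rightarrow> ereal" where
  "next_instant B K P \<sigma> a y =
     (if y a = 0 then \<infinity>
      else Inf (ereal ` {s. a < s \<and> triggered B K P \<sigma> (y s) (y s - y a)}))"

text \<open>
  \<open>t\<close> is the sequence of transmission instants and \<open>x\<close> the state of a run of the
  closed loop. A run with finitely many transmissions has \<open>t k = \<infinity>\<close> from some \<open>k\<close> on.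
  The inequality is evaluated along the held flow \<open>y\<close> rather than along \<open>x\<close>, so that at
  \<open>t (Suc k)\<close> the error is the one before the reset, and so that the next instant is determined by
  the dynamics even before it is known that \<open>t k < t (Suc k)\<close>.
\<close>

definition event_triggered_run ::
  "real^'n^'n \<Rightarrow> real^'m^'n \<Rightarrow> real^'n^'m \<Rightarrow> real^'n^'n \<Rightarrow> real \<Rightarrow>
   (nat \<Rightarrow> ereal) \<Rightarrow> (real \<Rightarrow> real^'n) \<Rightarrow> bool" where
  "event_triggered_run A B K P \<sigma> t x \<longleftrightarrow>
     \<bar>t 0\<bar> \<noteq> \<infinity> \<and>
     (\<forall>k. if t k = \<infinity> then t (Suc k) = \<infinity>
          else (\<exists>y. held_flow A B K (real_of_ereal (t k)) y \<and>
                    t (Suc k) = next_instant B K P \<sigma> (real_of_ereal (t k)) y \<and>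
                    (\<forall>s. t k \<le> ereal s \<and> ereal s \<le> t (Suc k) \<longrightarrow> x s = y s)))"

end

theory Submission
  imports Defs
begin

text \<open>
  Since the held flow satisfies \<open>e' = A e + (A - B K) x(t\<^sub>k)\<close> with \<open>e(t\<^sub>k) = 0\<close>, the error is at most
  \<open>\<delta> \<bar>x(t\<^sub>k)\<bar>\<close> for a time that depends on \<open>\<delta>\<close>, \<open>A\<close> and \<open>A - B K\<close> only. On the other hand,
  a trigger forces \<open>\<bar>e\<bar> \<ge> c \<bar>x\<bar>\<close> with \<open>c > 0\<close>, because \<open>x\<^sup>T P x\<close> is bounded
  below by a positive multiple of \<open>\<bar>x\<bar>\<^sup>2\<close>; and \<open>x = x(t\<^sub>k) + e\<close>.
\<close>

lemma matrix_vector_pos_bounded: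
  fixes M :: "real^'n^'m"
  obtains C where "C > 0" "\<And>x. norm (M *v x) \<le> C * norm x"
  using bounded_linear.pos_bounded[OF matrix_vector_mul_bounded_linear[of M]]
  by (metis mult.commute)

text \<open>By compactness the continuous quadratic form attains its minimum on the unit sphere, and
  that minimum is positive. Homogeneity of degree two carries the bound to all vectors.\<close>

lemma sym_pos_def_coercive:
  fixes P :: "real^'n^'n"
  assumes "sym_pos_def P"
  obtains p where "p > 0" "\<And>x. p * (norm x)\<^sup>2 \<le> x \<bullet> (P *v x)"
proof -
  let ?q = "\<lambda>x. x \<bullet> (P *v x)"
  let ?S = "sphere (0::real^'n) 1"
  have "continuous_on ?S ?q"
    by (intro continuous_intros linear_continuous_on matrix_vector_mul_bounded_linear)
  moreover have "?S \<noteq> {}"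
    by simp
  ultimately obtain u where u: "u \<in> ?S" "\<And>x. x \<in> ?S \<Longrightarrow> ?q u \<le> ?q x"
    using continuous_attains_inf[OF compact_sphere] by blast
  have "u \<noteq> 0"
    using u(1) by auto
  then have "?q u > 0"
    using assms by (simp add: sym_pos_def_def)
  moreover have "?q u * (norm x)\<^sup>2 \<le> ?q x" for x
  proof (cases "x = 0")
    case False
    define w where "w = x /\<^sub>R norm x"
    have x: "x = norm x *\<^sub>R w"
      using False by (simp add: w_def)
    have "w \<in> ?S"
      using False by (simp add: w_def)
    then have "?q u \<le> ?q w"
      by (rule u(2))
    moreover have "?q x = (norm x)\<^sup>2 * ?q w"
      by (subst (1 2) x) (simp add: matrix_vector_mult_scaleR power2_eq_square)
    ultimately show ?thesis
      by (simp add: mult_left_mono mult.commute[of "?q u"])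
  qed simp
  ultimately show ?thesis
    using that by blast
qed

text \<open>Coercivity and Cauchy-Schwarz turn a trigger into
  \<open>\<sigma> * p * |x|^2 \<le> 2 * C * |x| * |e|\<close>; cancelling one factor
  \<open>|x|\<close> leaves a linear bound.\<close>

lemma triggered_imp_error_ge:
  fixes P :: "real^'n^'n" and B :: "real^'m^'n" and K :: "real^'n^'m"
  assumes "sym_pos_def P" and "\<sigma> > 0"
  obtains c where "c > 0" "\<And>x e. triggered B K P \<sigma> x e \<Longrightarrow> c * norm x \<le> norm e"
proof -
  obtain p where p: "p > 0" "\<And>x. p * (norm x)\<^sup>2 \<le> x \<bullet> (P *v x)"
    using sym_pos_def_coercive[OF assms(1)] by blast
  obtain C where C: "C > 0" "\<And>e. norm ((P ** B ** K) *v e) \<le> C * norm e"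
    using matrix_vector_pos_bounded by blast
  have "\<sigma> * p / (2 * C) * norm x \<le> norm e" if "triggered B K P \<sigma> x e" for x e
  proof (cases "x = 0")
    case False
    have "\<sigma> * p * (norm x)\<^sup>2 \<le> \<sigma> * (x \<bullet> (P *v x))"
      using p(2)[of x] assms(2) by simp
    also have "\<dots> \<le> 2 * (x \<bullet> ((P ** B ** K) *v e))"
      using that by (simp add: triggered_def)
    also have "\<dots> \<le> 2 * (norm x * (C * norm e))"
      using norm_cauchy_schwarz[of x "(P ** B ** K) *v e"]
        mult_left_mono[OF C(2)[of e] norm_ge_zero[of x]] by linarith
    finally have "norm x * (\<sigma> * p * norm x) \<le> norm x * (2 * C * norm e)"
      by (simp add: power2_eq_square algebra_simps)
    then have "\<sigma> * p * norm x \<le> 2 * C * norm e"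
      using False by simp
    then show ?thesis
      using C(1) by (simp add: field_simps)
  qed simp
  moreover have "\<sigma> * p / (2 * C) > 0"
    using assms(2) p(1) C(1) by simp
  ultimately show ?thesis
    using that by blast
qed

text \<open>A substitute for Gronwall on a short interval: by the mean value inequality the largest
  error \<open>E\<close> satisfies \<open>E \<le> h * (L * E + M * |y a|)\<close>, and
  \<open>L * h \<le> 1 / 2\<close> lets the left side absorb the \<open>E\<close> on the
  right.\<close>

lemma held_flow_error_le:
  fixes A :: "real^'n^'n" and B :: "real^'m^'n" and K :: "real^'n^'m"
  assumes flow: "held_flow A B K a y"
    and L: "\<And>x. norm (A *v x) \<le> L * norm x" "L \<ge> 0"
    and M: "\<And>x. norm ((A - B ** K) *v x) \<le> M * norm x"
    and h: "L * h \<le> 1 / 2"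
    and s: "a \<le> s" "s \<le> a + h"
  shows "norm (y s - y a) \<le> 2 * h * M * norm (y a)"
proof -
  let ?I = "{a..a + h}"
  let ?v = "\<lambda>r. A *v y r - (B ** K) *v y a"
  have der: "(y has_vector_derivative ?v r) (at r within ?I)" if "r \<in> ?I" for r
    using flow that unfolding held_flow_def
    by (meson atLeastAtMost_iff atLeastatMost_subset_iff has_vector_derivative_within_subset
        Icc_subset_Ici_iff order_refl)
  have "continuous_on ?I y"
    using der by (rule continuous_on_vector_derivative)
  then have "continuous_on ?I (\<lambda>r. norm (y r - y a))"
    by (intro continuous_intros)
  moreover have "?I \<noteq> {}"
    using s by auto
  ultimately obtain m where m: "m \<in> ?I" "\<And>r. r \<in> ?I \<Longrightarrow> norm (y r - y a) \<le> norm (y m - y a)"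
    using continuous_attains_sup[OF compact_Icc] by blast
  define E where "E = norm (y m - y a)"
  define D where "D = L * E + M * norm (y a)"
  have speed: "norm (?v r) \<le> D" if "r \<in> ?I" for r
  proof -
    have "?v r = A *v (y r - y a) + (A - B ** K) *v y a"
      by (simp add: matrix_vector_mult_diff_distrib matrix_vector_mult_diff_rdistrib)
    also have "norm \<dots> \<le> L * norm (y r - y a) + M * norm (y a)"
      using L(1) M by (intro norm_triangle_mono)
    also have "\<dots> \<le> D"
      using m(2)[OF that] L(2) by (simp add: D_def E_def mult_left_mono)
    finally show ?thesis .
  qed
  have "norm (y m - y a) \<le> D * norm (m - a)"
  proof (rule differentiable_bound[of ?I y "\<lambda>r d. d *\<^sub>R ?v r"])
    show "(y has_derivative (\<lambda>d. d *\<^sub>R ?v r)) (at r within ?I)" if "r \<in> ?I" for r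
      using der[OF that] by (simp add: has_vector_derivative_def)
    show "onorm (\<lambda>d. d *\<^sub>R ?v r) \<le> D" if "r \<in> ?I" for r
      using speed[OF that] by (intro onorm_le) (simp add: mult.commute[of D] mult_left_mono)
  qed (use m(1) in auto)
  \<comment> \<open>The sign of \<open>M\<close> is not given, so nonnegativity comes from
    \<open>D\<close> bounding a norm.\<close>
  moreover have "D \<ge> 0"
    using speed[OF m(1)] norm_ge_zero order_trans by blast
  then have "D * norm (m - a) \<le> D * h"
    using m(1) by (intro mult_left_mono) auto
  ultimately have "E \<le> (L * h) * E + h * M * norm (y a)"
    by (simp add: E_def D_def algebra_simps)
  moreover have "(L * h) * E \<le> 1 / 2 * E"
    using h by (intro mult_right_mono) (simp_all add: E_def)
  moreover have "norm (y s - y a) \<le> E"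
    using m(2)[of s] s by (simp add: E_def)
  ultimately show ?thesis
    by linarith
qed

lemma held_flow_error_small:
  fixes A :: "real^'n^'n" and B :: "real^'m^'n" and K :: "real^'n^'m"
  assumes "\<delta> > 0"
  obtains h where "h > 0"
    "\<And>a y s. held_flow A B K a y \<Longrightarrow> a \<le> s \<Longrightarrow> s \<le> a + h \<Longrightarrow> norm (y s - y a) \<le> \<delta> * norm (y a)"
proof -
  obtain L where L: "L > 0" "\<And>x. norm (A *v x) \<le> L * norm x"
    using matrix_vector_pos_bounded by blast
  obtain M where M: "M > 0" "\<And>x. norm ((A - B ** K) *v x) \<le> M * norm x"
    using matrix_vector_pos_bounded by blast
  \<comment> \<open>The first term allows the absorption, the second brings the factor
    \<open>2 * h * M\<close> below \<open>\<delta>\<close>. Only the matrices and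
    \<open>\<delta>\<close> enter, so \<open>h\<close> serves every start time and state.\<close>
  define h where "h = min (1 / (2 * L)) (\<delta> / (2 * M))"
  have "h > 0"
    using L(1) M(1) assms by (simp add: h_def)
  moreover have "norm (y s - y a) \<le> \<delta> * norm (y a)"
    if "held_flow A B K a y" "a \<le> s" "s \<le> a + h" for a y s
  proof -
    have "h \<le> 1 / (2 * L)" "h \<le> \<delta> / (2 * M)"
      by (simp_all add: h_def)
    then have "L * h \<le> 1 / 2" "2 * h * M \<le> \<delta>"
      using L(1) M(1) by (simp_all add: field_simps)
    then show ?thesis
      using held_flow_error_le[OF that(1) L(2) less_imp_le[OF L(1)] M(2) _ that(2,3)]
        mult_right_mono[of "2 * h * M" \<delta> "norm (y a)"] by fastforce
  qed
  ultimately show ?thesis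
    using that by blast
qed

lemma next_instant_ge_uniform:
  fixes A P :: "real^'n^'n" and B :: "real^'m^'n" and K :: "real^'n^'m"
  assumes "sym_pos_def P" and "\<sigma> > 0"
  obtains h where "h > 0"
    "\<And>a y. held_flow A B K a y \<Longrightarrow> ereal (a + h) \<le> next_instant B K P \<sigma> a y"
proof -
  obtain c where c: "c > 0" "\<And>x e. triggered B K P \<sigma> x e \<Longrightarrow> c * norm x \<le> norm e"
    using triggered_imp_error_ge[OF assms] by blast
  \<comment> \<open>A trigger at \<open>s\<close> forces
    \<open>c * |y a| \<le> (1 + c) * |y s - y a|\<close>. This choice gives
    \<open>(1 + c) * \<delta> = c / 2\<close>, which contradicts that bound while the error is at
    most \<open>\<delta> * |y a|\<close>.\<close>
  define \<delta> where "\<delta> = c / (2 * (1 + c))"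
  have \<delta>: "\<delta> > 0" "(1 + c) * \<delta> < c"
    using c(1) by (simp_all add: \<delta>_def field_simps add_pos_pos)
  obtain h where h: "h > 0"
    "\<And>a y s. held_flow A B K a y \<Longrightarrow> a \<le> s \<Longrightarrow> s \<le> a + h \<Longrightarrow> norm (y s - y a) \<le> \<delta> * norm (y a)"
    using held_flow_error_small[OF \<delta>(1)] by blast
  have "ereal (a + h) \<le> next_instant B K P \<sigma> a y" if flow: "held_flow A B K a y" for a y
  proof -
    have "a + h \<le> s" if "y a \<noteq> 0" "a < s" "triggered B K P \<sigma> (y s) (y s - y a)" for s
    proof (rule ccontr)
      assume "\<not> a + h \<le> s"
      then have e: "norm (y s - y a) \<le> \<delta> * norm (y a)"
        using h(2)[OF flow] that(2) by simp
      have "norm (y a) \<le> norm (y s) + norm (y s - y a)"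
        using norm_triangle_sub[of "y a" "y s"] by (simp add: norm_minus_commute)
      then have "c * norm (y a) \<le> c * (norm (y s) + norm (y s - y a))"
        using c(1) by simp
      also have "\<dots> \<le> (1 + c) * norm (y s - y a)"
        using c(2)[OF that(3)] by (simp add: algebra_simps)
      also have "\<dots> \<le> (1 + c) * \<delta> * norm (y a)"
        using e c(1) by simp
      also have "\<dots> < c * norm (y a)"
        using \<delta>(2) that(1) by simp
      finally show False
        by simp
    qed
    \<comment> \<open>For \<open>y a = 0\<close> the next instant is \<open>\<infinity>\<close>;
      otherwise \<open>a + h\<close> is a lower bound of the set of triggering times, even if that
      set is empty.\<close>
    then show ?thesis
      by (auto simp: next_instant_def intro!: Inf_greatest)
  qed
  then show ?thesis
    using that h(1) by blast
qed

theorem theorem2: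
  fixes A Q P :: "real^'n^'n" and B :: "real^'m^'n" and K :: "real^'n^'m" and \<sigma> :: real
  assumes "stabilizable A B"
    and "hurwitz (A - B ** K)"
    and "sym_pos_def Q"
    and "sym_pos_def P"
    and "transpose (A - B ** K) ** P + P ** (A - B ** K) = - Q"
    and "0 < \<sigma>" and "\<sigma> < 1"
  shows "\<exists>\<tau>::real. \<tau> > 0 \<and>
           (\<forall>t x. event_triggered_run A B K P \<sigma> t x \<longrightarrow>
              (\<forall>k. t k \<noteq> \<infinity> \<longrightarrow> t (Suc k) - t k \<ge> ereal \<tau>))"
proof -
  obtain h where h: "h > 0"
    "\<And>a y. held_flow A B K a y \<Longrightarrow> ereal (a + h) \<le> next_instant B K P \<sigma> a y"
    using next_instant_ge_uniform[OF assms(4,6)] by blast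
  have "t (Suc k) - t k \<ge> ereal h"
    if run: "event_triggered_run A B K P \<sigma> t x" and "t k \<noteq> \<infinity>" for t x k
  proof -
    \<comment> \<open>\<open>real_of_ereal\<close> sends both infinities to 0, so the bound makes
      sense for every \<open>j\<close> before \<open>t j\<close> is known to be finite.\<close>
    have step: "ereal (real_of_ereal (t j) + h) \<le> t (Suc j)" for j
    proof (cases "t j = \<infinity>")
      case True
      then have "t (Suc j) = \<infinity>"
        using run by (auto simp: event_triggered_run_def)
      then show ?thesis
        by simp
    next
      case False
      then obtain y where "held_flow A B K (real_of_ereal (t j)) y"
        "t (Suc j) = next_instant B K P \<sigma> (real_of_ereal (t j)) y"
        using run unfolding event_triggered_run_def by (metis (no_types))
      then show ?thesis
        using h(2) by simp
    qed
    \<comment> \<open>The start is finite by definition of a run, and each later instant has a real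
      lower bound by \<open>step\<close>. With \<open>t k\<close> real, the difference is either
      real or \<open>\<infinity>\<close>.\<close>
    have "t k \<noteq> - \<infinity>"
    proof (cases k)
      case 0
      then show ?thesis
        using run by (auto simp: event_triggered_run_def)
    next
      case (Suc j)
      then show ?thesis
        using step[of j] by auto
    qed
    then show ?thesis
      using step[of k] \<open>t k \<noteq> \<infinity>\<close> by (cases "t k"; cases "t (Suc k)") auto
  qed
  then show ?thesis
    using h(1) by blast
qed

end
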